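(* Let $V_1$ and $V_2$ be real topological vector spaces. Let $\mathcal{R}\subseteq V_1$ be convex and let $\Delta\subseteq V_2$ be nonempty, convex, and compact. Let $\mathrm{cost}\colon\mathcal{R}\times\Delta\to(0,\infty]$ be semicontinuous and saddle, and let $\mathrm{score}\colon\mathcal{R}\times\Delta\to[0,\infty)$ be such that $-\mathrm{score}$ is semicontinuous and saddle. Then, using $x/0=\infty$ for $x\in(0,\infty]$, \[\inf_{R\in\mathcal{R}}\max_{\mu\in\Delta}\frac{\mathrm{cost}(R,\mu)}{\mathrm{score}(R,\mu)}=\max_{\mu\in\Delta}\inf_{R\in\mathcal{R}}\frac{\mathrm{cost}(R,\mu)}{\mathrm{score}(R,\mu)},\] and the maximums are attained.
   Context: A function $\phi$ on a convex set is convex if $\phi(\lambda x+(1-\lambda)y)\le\lambda\phi(x)+(1-\lambda)\phi(y)$ for all $x,y$ and $\lambda\in(0,1)$, and concave if $-\phi$ is convex. A function $\alpha\colon X\times Y\to[-\infty,\infty]$ is saddle if $\alpha(\cdot,y)$ is convex for every $y$ and $\alpha(x,\cdot)$ is concave for every $x$; it is semicontinuous if $\alpha(x,\cdot)$ is upper semicontinuous on $Y$ for every $x$ and $\alpha(\cdot,y)$ is lower semicontinuous on $X$ for every $y$. ($\phi$ is upper semicontinuous at $x$ if for every $y>\phi(x)$ there is a neighborhood of $x$ on which $\phi<y$; lower semicontinuous if $-\phi$ is upper semicontinuous.) The extended reals carry the order topology. *)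

theory Defs
  imports "HOL-Analysis.Analysis"
begin

text \<open>Real topological vector spaces; no separation axiom is imposed.\<close>

class real_tvs = real_vector + topological_ab_group_add +
  assumes tendsto_scaleR_Pair:
    "LIM p (nhds (c :: real) \<times>\<^sub>F nhds x). fst p *\<^sub>R snd p :> nhds (c *\<^sub>R x)"

instance real_normed_vector \<subseteq> real_tvs
proof
  fix c :: real and x :: 'a
  show "LIM p (nhds c \<times>\<^sub>F nhds x). fst p *\<^sub>R snd p :> nhds (c *\<^sub>R x)"
    by (intro tendsto_scaleR filterlim_fst filterlim_snd)
qed

text \<open>
  On \<^typ>\<open>ereal\<close> the sum of \<open>\<infinity>\<close> and \<open>-\<infinity>\<close> is \<open>\<infinity>\<close>, so the inequality below is vacuous
  whenever its right-hand side is indeterminate.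
\<close>

definition econvex_on :: "'a::real_vector set \<Rightarrow> ('a \<Rightarrow> ereal) \<Rightarrow> bool" where
  "econvex_on S f \<longleftrightarrow> convex S \<and>
    (\<forall>x\<in>S. \<forall>y\<in>S. \<forall>u::real. 0 < u \<and> u < 1 \<longrightarrow>
      f (u *\<^sub>R x + (1 - u) *\<^sub>R y) \<le> ereal u * f x + ereal (1 - u) * f y)"

definition econcave_on :: "'a::real_vector set \<Rightarrow> ('a \<Rightarrow> ereal) \<Rightarrow> bool" where
  "econcave_on S f \<longleftrightarrow> econvex_on S (\<lambda>x. - f x)"

definition saddle_on ::
  "'a::real_vector set \<Rightarrow> 'b::real_vector set \<Rightarrow> ('a \<Rightarrow> 'b \<Rightarrow> ereal) \<Rightarrow> bool" where
  "saddle_on X Y f \<longleftrightarrow>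
    (\<forall>y\<in>Y. econvex_on X (\<lambda>x. f x y)) \<and> (\<forall>x\<in>X. econcave_on Y (\<lambda>y. f x y))"

definition usc_on :: "'a::topological_space set \<Rightarrow> ('a \<Rightarrow> ereal) \<Rightarrow> bool" where
  "usc_on S f \<longleftrightarrow>
    (\<forall>x\<in>S. \<forall>y>f x. \<exists>U. open U \<and> x \<in> U \<and> (\<forall>z\<in>U \<inter> S. f z < y))"

definition lsc_on :: "'a::topological_space set \<Rightarrow> ('a \<Rightarrow> ereal) \<Rightarrow> bool" where
  "lsc_on S f \<longleftrightarrow> usc_on S (\<lambda>x. - f x)"

definition semicontinuous_on ::
  "'a::topological_space set \<Rightarrow> 'b::topological_space set \<Rightarrow> ('a \<Rightarrow> 'b \<Rightarrow> ereal) \<Rightarrow> bool" where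
  "semicontinuous_on X Y f \<longleftrightarrow>
    (\<forall>x\<in>X. usc_on Y (\<lambda>y. f x y)) \<and> (\<forall>y\<in>Y. lsc_on X (\<lambda>x. f x y))"

text \<open>The library's division on \<^typ>\<open>ereal\<close> already follows the convention \<open>x / 0 = \<infinity>\<close>.\<close>

lemma ereal_pos_divide_zero: "0 < x \<Longrightarrow> x / 0 = (\<infinity> :: ereal)"
  by (simp add: divide_ereal_def)

end

theory Submission
  imports Defs
begin

text \<open>
  The ratio is lower semicontinuous and quasiconvex in \<open>R\<close>, and upper semicontinuous and
  quasiconcave in \<open>\<mu>\<close>: for real \<open>r > 0\<close> the conditions \<open>cost / score \<le> r\<close> and
  \<open>r \<le> cost / score\<close> say that \<open>cost - r * score\<close> is \<open>\<le> 0\<close> and \<open>\<ge> 0\<close>, and this difference is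
  semicontinuous and saddle. Hence Sion's minimax theorem applies, which is proved here by
  Komiya's connectedness argument. The compactness step yields a maximiser on the right-hand side,
  and the case of a single \<open>R\<close> yields the maximisers on the left-hand side.
\<close>

section \<open>Segments and convex sets in topological vector spaces\<close>

lemma continuous_on_segment_real_tvs:
  fixes x y :: "'a::real_tvs"
  shows "continuous_on S (\<lambda>u::real. x + u *\<^sub>R (y - x))"
proof -
  have "((\<lambda>u. u *\<^sub>R (y - x)) \<longlongrightarrow> c *\<^sub>R (y - x)) (at c within S)" for c
  proof -
    \<comment> \<open>Joint continuity of scaling is available only as a limit along a product
      filter, so the pair with constant second entry is sent into that product.\<close>
    have "LIM u (at c within S). (u, y - x) :> nhds c \<times>\<^sub>F nhds (y - x)"
      by (intro filterlim_Pair tendsto_const tendsto_ident_at)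
    from filterlim_compose[OF tendsto_scaleR_Pair this] show ?thesis
      by simp
  qed
  then have "continuous_on S (\<lambda>u::real. u *\<^sub>R (y - x))"
    by (simp add: continuous_on_def)
  then show ?thesis
    by (intro continuous_on_add continuous_on_const)
qed

lemma convex_segment_mem:
  fixes x y :: "'a::real_vector"
  assumes "convex C" "x \<in> C" "y \<in> C" "u \<in> {0..1}"
  shows "x + u *\<^sub>R (y - x) \<in> C"
proof -
  have "(1 - u) *\<^sub>R x + u *\<^sub>R y \<in> C"
    using assms by (intro convexD) auto
  then show ?thesis
    by (simp add: algebra_simps)
qed

lemma convex_imp_connected_real_tvs:
  fixes C :: "'a::real_tvs set"
  assumes "convex C"
  shows "connected C"
  unfolding connected_iff_connected_component
proof (intro ballI)
  fix x y assume xy: "x \<in> C" "y \<in> C"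
  let ?z = "\<lambda>u::real. x + u *\<^sub>R (y - x)"
  have "connected (?z ` {0..1})"
    by (intro connected_continuous_image continuous_on_segment_real_tvs connected_Icc)
  moreover have "?z ` {0..1} \<subseteq> C"
    using convex_segment_mem[OF assms xy] by blast
  moreover have "x \<in> ?z ` {0..1}"
    by (rule image_eqI[of _ _ 0]) auto
  moreover have "y \<in> ?z ` {0..1}"
    by (rule image_eqI[of _ _ 1]) auto
  ultimately show "connected_component C x y"
    unfolding connected_component_def by blast
qed

section \<open>Sion's minimax theorem\<close>

text \<open>Closedness is relative to \<open>X\<close> and \<open>Y\<close>, matching semicontinuity
  on these sets only; without a separation axiom a compact \<open>Y\<close> need not be closed. The
  level \<open>t\<close> may be infinite: \<open>t = -\<infinity>\<close> makes \<open>Y\<close>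
  convex once \<open>X\<close> is nonempty.\<close>

locale quasi_saddle =
  fixes X :: "'a::real_tvs set" and Y :: "'b::real_tvs set" and f :: "'a \<Rightarrow> 'b \<Rightarrow> ereal"
  assumes convex_X: "convex X"
    and compact_Y: "compact Y"
    and convex_sub: "\<And>y t. y \<in> Y \<Longrightarrow> convex {x \<in> X. f x y \<le> t}"
    and closed_sub: "\<And>y t. y \<in> Y \<Longrightarrow> closedin (top_of_set X) {x \<in> X. f x y \<le> t}"
    and convex_super: "\<And>x t. x \<in> X \<Longrightarrow> convex {y \<in> Y. t \<le> f x y}"
    and closed_super: "\<And>x t. x \<in> X \<Longrightarrow> closedin (top_of_set Y) {y \<in> Y. t \<le> f x y}"
begin

text \<open>Lower semicontinuity in \<open>x\<close> is pulled back to the unit interval, where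
  connectedness will be used.\<close>

lemma openin_segment_gt:
  assumes "x1 \<in> X" "x2 \<in> X" "y \<in> Y"
  shows "openin (top_of_set {0..1}) {u \<in> {0..1}. t < f (x1 + u *\<^sub>R (x2 - x1)) y}"
proof -
  let ?z = "\<lambda>u::real. x1 + u *\<^sub>R (x2 - x1)"
  have "?z ` {0..1} \<subseteq> X"
    using convex_segment_mem[OF convex_X assms(1,2)] by blast
  then have "closedin (top_of_set {0..1}) ({0..1} \<inter> ?z -` {x \<in> X. f x y \<le> t})"
    using continuous_on_segment_real_tvs closed_sub[OF assms(3)]
    by (intro continuous_closedin_preimage_gen[where T = X]) auto
  then have "openin (top_of_set {0..1}) ({0..1} - ({0..1} \<inter> ?z -` {x \<in> X. f x y \<le> t}))"
    by (intro openin_diff openin_subtopology_self)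
  moreover have "{0..1} - ({0..1} \<inter> ?z -` {x \<in> X. f x y \<le> t}) = {u \<in> {0..1}. t < f (?z u) y}"
    using \<open>?z ` {0..1} \<subseteq> X\<close> by (auto simp: not_le)
  ultimately show ?thesis
    by simp
qed

text \<open>
  If the two superlevel sets of level \<open>\<beta>\<close> were disjoint in \<open>K\<close>, then for each \<open>z\<close> on the segment
  the connected superlevel set at \<open>z\<close>, which they cover, would lie in exactly one of them. The
  strict inequality \<open>\<beta> < \<alpha>\<close> makes this choice locally constant in \<open>z\<close>.
\<close>

lemma superlevels_two_meet:
  assumes K: "closedin (top_of_set Y) K" "convex K"
    and x: "x1 \<in> X" "x2 \<in> X"
    and "\<beta> < \<alpha>"
    and ne: "\<And>x. x \<in> X \<Longrightarrow> \<exists>y\<in>K. \<alpha> \<le> f x y"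
  shows "\<exists>y\<in>K. \<beta> \<le> f x1 y \<and> \<beta> \<le> f x2 y"
proof (rule ccontr)
  assume disj: "\<not> ?thesis"
  define z where "z u = x1 + u *\<^sub>R (x2 - x1)" for u :: real
  define L where "L x = {y \<in> K. \<beta> \<le> f x y}" for x
  have KY: "K \<subseteq> Y"
    using K(1) closedin_subset by fastforce
  have L_eq: "L x = K \<inter> {y \<in> Y. \<beta> \<le> f x y}" for x
    using KY by (auto simp: L_def)
  have zX: "z u \<in> X" if "u \<in> {0..1}" for u
    using convex_segment_mem[OF convex_X x that] by (simp add: z_def)
  have L_closed: "closedin (top_of_set Y) (L x)" if "x \<in> X" for x
    unfolding L_eq using K(1) closed_super[OF that] by (rule closedin_Int)
  have L_conn: "connected (L x)" if "x \<in> X" for x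
    unfolding L_eq using K(2) convex_super[OF that]
    by (intro convex_imp_connected_real_tvs convex_Int)
  have L_disj: "L x1 \<inter> L x2 = {}"
    using disj by (auto simp: L_def)
  have L_cover: "L (z u) \<subseteq> L x1 \<union> L x2" if u: "u \<in> {0..1}" for u
  proof
    fix y assume y: "y \<in> L (z u)"
    then have "y \<in> Y"
      using KY by (auto simp: L_def)
    \<comment> \<open>Quasiconvexity at the level of the larger endpoint value: a lower bound at
      \<open>z u\<close> passes to one of the endpoints.\<close>
    have "z u \<in> {x \<in> X. f x y \<le> max (f x1 y) (f x2 y)}"
      unfolding z_def using x by (intro convex_segment_mem convex_sub u \<open>y \<in> Y\<close>) auto
    then show "y \<in> L x1 \<union> L x2"
      using y by (auto simp: L_def max_def split: if_splits)
  qed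
  have dichotomy: "L (z u) \<subseteq> L x1 \<or> L (z u) \<subseteq> L x2" if u: "u \<in> {0..1}" for u
  proof -
    \<comment> \<open>The traces of \<open>L x1\<close> and \<open>L x2\<close> are disjoint, closed
      in the connected set \<open>L (z u)\<close> and cover it, so one is empty.\<close>
    have "closedin (top_of_set (L (z u))) (L (z u) \<inter> L xi)" if "xi \<in> X" for xi
      using closedin_subset_trans[of Y "L xi \<inter> L (z u)" "L (z u)"]
        closedin_Int[OF L_closed[OF that] L_closed[OF zX[OF u]]] L_closed[OF zX[OF u]]
      by (auto simp: Int_commute dest: closedin_subset)
    then have "L (z u) \<inter> L x1 = {} \<or> L (z u) \<inter> L x2 = {}"
      using L_conn[OF zX[OF u]] x L_cover[OF u] L_disj
      unfolding connected_closedin by blast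
    then show ?thesis
      using L_cover[OF u] by blast
  qed
  \<comment> \<open>By the dichotomy and nonemptiness of \<open>L (z u)\<close>, meeting
    \<open>L xi\<close> is the same as lying inside it.\<close>
  define I where "I xi = {u \<in> {0..1}. \<exists>y\<in>L (z u). y \<in> L xi}" for xi
  have nonempty: "\<exists>y\<in>K. \<alpha> \<le> f (z u) y" if "u \<in> {0..1}" for u
    using ne zX[OF that] by blast
  have I_open: "openin (top_of_set {0..1}) (I xi)" if xi: "xi = x1 \<or> xi = x2" for xi
  proof (subst openin_subopen, intro ballI)
    fix u assume "u \<in> I xi"
    then have u: "u \<in> {0..1}" and "L (z u) \<subseteq> L xi"
      using dichotomy L_disj xi by (auto simp: I_def)
    \<comment> \<open>A point of level \<alpha> exceeds \<beta> strictly, and this persists for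
      nearby parameters: the same \<open>y\<close> witnesses membership in \<open>I xi\<close>
      there.\<close>
    obtain y where y: "y \<in> K" "\<alpha> \<le> f (z u) y"
      using nonempty[OF u] by blast
    then have gt: "\<beta> < f (z u) y"
      using \<open>\<beta> < \<alpha>\<close> by simp
    then have "y \<in> L xi"
      using y(1) \<open>L (z u) \<subseteq> L xi\<close> by (auto simp: L_def)
    then have "{v \<in> {0..1}. \<beta> < f (z v) y} \<subseteq> I xi"
      using y(1) by (auto simp: I_def L_def)
    moreover have "openin (top_of_set {0..1}) {v \<in> {0..1}. \<beta> < f (z v) y}"
      unfolding z_def using x y(1) KY by (intro openin_segment_gt) auto
    ultimately show "\<exists>T. openin (top_of_set {0..1}) T \<and> u \<in> T \<and> T \<subseteq> I xi"
      using u gt by blast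
  qed
  have in_I: "u \<in> I x1 \<or> u \<in> I x2" if u: "u \<in> {0..1}" for u
  proof -
    obtain y where "y \<in> K" "\<alpha> \<le> f (z u) y"
      using nonempty[OF u] by blast
    then have "y \<in> L (z u)"
      using \<open>\<beta> < \<alpha>\<close> by (auto simp: L_def)
    then show ?thesis
      using dichotomy[OF u] u by (auto simp: I_def)
  qed
  have "I x1 \<inter> I x2 = {}"
    using dichotomy L_disj by (fastforce simp: I_def)
  moreover have "z 0 = x1" "z 1 = x2"
    by (simp_all add: z_def)
  then have "0 \<in> I x1" "1 \<in> I x2"
    using in_I[of 0] in_I[of 1] by (auto simp: I_def)
  moreover have "{0..1} \<subseteq> I x1 \<union> I x2"
    using in_I by blast
  ultimately show False
    using connected_Icc[of "0::real" 1] I_open[of x1] I_open[of x2]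
    unfolding connected_openin by blast
qed

text \<open>Each induction step cuts \<open>K\<close> down to the superlevel set of \<open>a\<close>
  at an intermediate level \<gamma>. The two-point lemma for \<open>a\<close> and \<open>x\<close>
  restores the last hypothesis for the smaller set, with \<gamma> in place of \<alpha>; hence both
  \<open>K\<close> and \<alpha> vary in the induction.\<close>

lemma superlevels_finite_meet:
  assumes "finite F" "F \<subseteq> X" "X \<noteq> {}"
    and "closedin (top_of_set Y) K" "convex K" "\<beta> < \<alpha>"
    and "\<And>x. x \<in> X \<Longrightarrow> \<exists>y\<in>K. \<alpha> \<le> f x y"
  shows "\<exists>y\<in>K. \<forall>x\<in>F. \<beta> \<le> f x y"
  using assms
proof (induction F arbitrary: K \<alpha>)
  case empty
  then show ?case by blast
next
  case (insert a F)
  obtain \<gamma> where \<gamma>: "\<beta> < \<gamma>" "\<gamma> < \<alpha>"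
    using dense \<open>\<beta> < \<alpha>\<close> by blast
  define K' where "K' = K \<inter> {y \<in> Y. \<gamma> \<le> f a y}"
  have KY: "K \<subseteq> Y"
    using insert.prems(3) closedin_subset by fastforce
  have a: "a \<in> X"
    using insert.prems(1) by simp
  have "\<exists>y\<in>K'. \<forall>x\<in>F. \<beta> \<le> f x y"
  proof (rule insert.IH)
    show "F \<subseteq> X" "X \<noteq> {}" "\<beta> < \<gamma>"
      using insert.prems \<gamma> by auto
    show "closedin (top_of_set Y) K'"
      unfolding K'_def using insert.prems(3) closed_super[OF a] by (rule closedin_Int)
    show "convex K'"
      unfolding K'_def using insert.prems(4) convex_super[OF a] by (rule convex_Int)
    show "\<exists>y\<in>K'. \<gamma> \<le> f x y" if "x \<in> X" for x
      using superlevels_two_meet[OF insert.prems(3,4) a that \<gamma>(2) insert.prems(6)] KY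
      by (auto simp: K'_def)
  qed
  then obtain y where y: "y \<in> K" "\<gamma> \<le> f a y" "\<forall>x\<in>F. \<beta> \<le> f x y"
    by (auto simp: K'_def)
  then have "\<beta> \<le> f a y"
    using \<gamma>(1) by simp
  then show ?case
    using y by blast
qed

text \<open>Over a one-point set the outer infimum is trivial, so \<open>Sion_minimax\<close>
  becomes attainment of the supremum of \<open>f a\<close>.\<close>

lemma quasi_saddle_singleton:
  assumes "a \<in> X"
  shows "quasi_saddle {a} Y f"
proof
  fix y t assume "y \<in> Y"
  have eq: "{x \<in> {a}. f x y \<le> t} = (if f a y \<le> t then {a} else {})"
    by auto
  show "convex {x \<in> {a}. f x y \<le> t}" "closedin (top_of_set {a}) {x \<in> {a}. f x y \<le> t}"
    unfolding eq by simp_all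
next
  fix x t assume "x \<in> {a}"
  then show "convex {y \<in> Y. t \<le> f x y}" "closedin (top_of_set Y) {y \<in> Y. t \<le> f x y}"
    using convex_super closed_super assms by auto
qed (use compact_Y in auto)

text \<open>One point \<open>y\<close> carries both the nontrivial minimax inequality and
  attainment. It comes from the finite intersection property of superlevel sets at all levels
  strictly below the value, since finitely many points are controlled only with a loss in
  level.\<close>

theorem Sion_minimax:
  assumes "Y \<noteq> {}"
  shows "\<exists>y\<in>Y. \<forall>x\<in>X. (INF x\<in>X. SUP y\<in>Y. f x y) \<le> f x y"
proof (cases "X = {}")
  case True
  then show ?thesis using assms by auto
next
  case False
  define v where "v = (INF x\<in>X. SUP y\<in>Y. f x y)"
  define C where "C = (\<lambda>(x, t). {y \<in> Y. t \<le> f x y})"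
  have "\<exists>y\<in>Y. \<forall>x\<in>X. v \<le> f x y"
  \<comment> \<open>With no level below \<open>v\<close> the family would be empty and its
    intersection would not place \<open>y\<close> in \<open>Y\<close>.\<close>
  proof (cases "v = -\<infinity>")
    case True
    then show ?thesis using assms by auto
  next
    case v: False
    have fip: "\<Inter>F \<noteq> {}" if "finite F" "F \<subseteq> C ` (X \<times> {..<v})" for F
    proof -
      from finite_subset_image[OF that(1,2)]
      obtain G where G: "G \<subseteq> X \<times> {..<v}" "finite G" "F = C ` G"
        by (elim exE conjE)
      show ?thesis
      proof (cases "G = {}")
        case True
        then show ?thesis using G by simp
      next
        case G_ne: False
        \<comment> \<open>The finite lemma uses one common level, so the largest of the finitely
          many levels is taken.\<close>
        define \<beta> where "\<beta> = Max (snd ` G)"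
        have "\<beta> \<in> snd ` G"
          unfolding \<beta>_def using G(2) G_ne by (intro Max_in) auto
        then have "\<beta> < v"
          using G(1) by auto
        then obtain \<alpha> where \<alpha>: "\<beta> < \<alpha>" "\<alpha> < v"
          using dense by blast
        have ne: "\<exists>y\<in>Y. \<alpha> \<le> f x y" if "x \<in> X" for x
        proof -
          have "\<alpha> < (SUP y\<in>Y. f x y)"
            using \<alpha>(2) INF_lower[OF that] unfolding v_def by (rule less_le_trans)
          then show ?thesis
            by (auto simp: less_SUP_iff intro: less_imp_le)
        qed
        obtain a where a: "a \<in> X"
          using \<open>X \<noteq> {}\<close> by blast
        have "convex Y"
          using convex_super[OF a, of "-\<infinity>"] by simp
        then have "\<exists>y\<in>Y. \<forall>x\<in>fst ` G. \<beta> \<le> f x y"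
          using G \<alpha>(1) ne \<open>X \<noteq> {}\<close> by (intro superlevels_finite_meet[where \<alpha> = \<alpha>]) auto
        then obtain y where y: "y \<in> Y" "\<And>p. p \<in> G \<Longrightarrow> \<beta> \<le> f (fst p) y"
          by auto
        have "snd p \<le> f (fst p) y" if "p \<in> G" for p
        proof -
          have "snd p \<le> \<beta>"
            unfolding \<beta>_def using G(2) that by (intro Max_ge) auto
          then show ?thesis
            using y(2)[OF that] by (rule order_trans)
        qed
        then have "y \<in> \<Inter>F"
          using y(1) by (auto simp: G(3) C_def)
        then show ?thesis by blast
      qed
    qed
    have "compact_space (top_of_set Y)"
      using compact_Y by (simp add: compact_space_subtopology)
    moreover have "\<forall>S\<in>C ` (X \<times> {..<v}). closedin (top_of_set Y) S"
      using closed_super by (auto simp: C_def)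
    ultimately have "\<Inter>(C ` (X \<times> {..<v})) \<noteq> {}"
      unfolding compact_space_fip using fip by blast
    then obtain y where y: "\<And>x t. x \<in> X \<Longrightarrow> t < v \<Longrightarrow> y \<in> Y \<and> t \<le> f x y"
      by (auto simp: C_def)
    have "v \<le> f x y" if "x \<in> X" for x
      using y[OF that] by (blast intro: dense_le)
    moreover have "y \<in> Y"
      using y False v by (metis ereal_infty_less(2) ex_in_conv)
    ultimately show ?thesis by blast
  qed
  then show ?thesis
    by (simp add: v_def)
qed

end

section \<open>Level sets of a ratio\<close>

lemma convexI_open_unit:
  assumes "\<And>x y u. x \<in> S \<Longrightarrow> y \<in> S \<Longrightarrow> 0 < u \<Longrightarrow> u < 1 \<Longrightarrow> u *\<^sub>R x + (1 - u) *\<^sub>R y \<in> S"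
  shows "convex S"
proof (rule convexI)
  fix x y u v assume *: "x \<in> S" "y \<in> S" "0 \<le> u" "0 \<le> v" "u + v = (1::real)"
  then have "v = 1 - u" by simp
  consider "u = 0" | "u = 1" | "0 < u" "u < 1"
    using * by fastforce
  then show "u *\<^sub>R x + v *\<^sub>R y \<in> S"
    using * assms[of x y u] \<open>v = 1 - u\<close> by cases auto
qed

text \<open>Positivity of \<open>c\<close> settles the case \<open>s = 0\<close>: here both sides
  are then true, and in the reversed version below both are false.\<close>

lemma ereal_le_divide_iff:
  fixes c s :: ereal
  assumes "0 < c" "0 \<le> s" "s < \<infinity>" "0 < r"
  shows "ereal r \<le> c / s \<longleftrightarrow> ereal r * s \<le> c"
  using assms
  by (cases c; cases s; cases "s = 0")
    (auto simp: divide_ereal_def field_simps zero_ereal_def)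

lemma ereal_divide_le_iff:
  fixes c s :: ereal
  assumes "0 < c" "0 \<le> s" "s < \<infinity>" "0 < r"
  shows "c / s \<le> ereal r \<longleftrightarrow> c \<le> ereal r * s"
  using assms
  by (cases c; cases s; cases "s = 0")
    (auto simp: divide_ereal_def field_simps zero_ereal_def)

text \<open>The quotient criteria need a positive real level; this reduces any level to such ones.
  For \<open>t \<le> 0\<close> the right-hand side is vacuous.\<close>

lemma ereal_le_iff_pos_reals_le:
  fixes a t :: ereal
  assumes "0 \<le> a"
  shows "t \<le> a \<longleftrightarrow> (\<forall>r>0. ereal r < t \<longrightarrow> ereal r \<le> a)"
proof
  assume R: "\<forall>r>0. ereal r < t \<longrightarrow> ereal r \<le> a"
  show "t \<le> a"
  proof (rule ccontr)
    assume "\<not> t \<le> a"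
    then obtain r where "a < ereal r" "ereal r < t"
      using ereal_dense2[of a t] not_le by blast
    moreover have "0 < r"
      using assms \<open>a < ereal r\<close> by (metis ereal_less(2) le_less_trans)
    ultimately show False
      using R by (auto simp: not_le)
  qed
qed (auto intro: less_imp_le order_trans)

lemma ereal_ge_iff_pos_reals_ge:
  fixes a t :: ereal
  assumes "0 \<le> t"
  shows "a \<le> t \<longleftrightarrow> (\<forall>r>0. t < ereal r \<longrightarrow> a \<le> ereal r)"
proof
  assume R: "\<forall>r>0. t < ereal r \<longrightarrow> a \<le> ereal r"
  show "a \<le> t"
  proof (rule ccontr)
    assume "\<not> a \<le> t"
    then obtain r where "t < ereal r" "ereal r < a"
      using ereal_dense2[of t a] not_le by blast
    moreover have "0 < r"
      using assms \<open>t < ereal r\<close> by (metis ereal_less(2) le_less_trans)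
    ultimately show False
      using R by (auto simp: not_le)
  qed
qed (auto intro: less_imp_le order_trans)

section \<open>Sets where one semicontinuous or convex function lies below another\<close>

lemma openin_usc_less:
  assumes "usc_on S g"
  shows "openin (top_of_set S) {x \<in> S. g x < t}"
proof (subst openin_subopen, intro ballI)
  fix x assume "x \<in> {x \<in> S. g x < t}"
  then obtain U where "open U" "x \<in> U" "\<forall>z\<in>U \<inter> S. g z < t" "x \<in> S"
    using assms unfolding usc_on_def by blast
  then show "\<exists>T. openin (top_of_set S) T \<and> x \<in> T \<and> T \<subseteq> {x \<in> S. g x < t}"
    by (intro exI[of _ "S \<inter> U"]) (auto intro: openin_open_Int)
qed

text \<open>The complement is split by an intermediate level \<open>q\<close> with
  \<open>g x < q < h x\<close>, which avoids the possibly indeterminate difference of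
  \<open>g\<close> and \<open>h\<close>.\<close>

lemma closedin_usc_le:
  assumes "usc_on S g" "lsc_on S h"
  shows "closedin (top_of_set S) {x \<in> S. h x \<le> g x}"
proof -
  have "{x \<in> S. g x < h x} = (\<Union>q. {x \<in> S. g x < q} \<inter> {x \<in> S. - h x < - q})"
    using dense by (auto intro: less_trans)
  also have "openin (top_of_set S) \<dots>"
    using assms unfolding lsc_on_def
    by (intro openin_Union) (elim imageE; simp only: openin_Int openin_usc_less)
  finally have "openin (top_of_set S) {x \<in> S. g x < h x}" .
  then have "closedin (top_of_set S) (S - {x \<in> S. g x < h x})"
    by (intro closedin_diff) auto
  moreover have "S - {x \<in> S. g x < h x} = {x \<in> S. h x \<le> g x}"
    by (auto simp: not_less)
  ultimately show ?thesis by simp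
qed

lemma usc_on_cmult:
  assumes "usc_on S g" "0 < r"
  shows "usc_on S (\<lambda>x. ereal r * g x)"
proof -
  have "ereal r * a < b \<longleftrightarrow> a < b / ereal r" for a b
    using assms(2) by (simp add: ereal_less_divide_pos)
  then show ?thesis
    using assms(1) unfolding usc_on_def by metis
qed

lemma econvex_on_cmult:
  assumes "econvex_on S g" "0 < r"
  shows "econvex_on S (\<lambda>x. ereal r * g x)"
  unfolding econvex_on_def
proof (intro conjI ballI allI impI)
  show "convex S"
    using assms(1) by (simp add: econvex_on_def)
next
  fix x y and u :: real assume xy: "x \<in> S" "y \<in> S" and u: "0 < u \<and> u < 1"
  have "g (u *\<^sub>R x + (1 - u) *\<^sub>R y) \<le> ereal u * g x + ereal (1 - u) * g y"
    using assms(1) xy u by (simp add: econvex_on_def)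
  then have "ereal r * g (u *\<^sub>R x + (1 - u) *\<^sub>R y) \<le> ereal r * (ereal u * g x + ereal (1 - u) * g y)"
    using assms(2) by (intro ereal_mult_left_mono) auto
  \<comment> \<open>A finite nonnegative factor distributes even over a sum of opposite
    infinities.\<close>
  also have "\<dots> = ereal r * (ereal u * g x) + ereal r * (ereal (1 - u) * g y)"
    using assms(2) by (intro ereal_pos_distrib) auto
  also have "\<dots> = ereal u * (ereal r * g x) + ereal (1 - u) * (ereal r * g y)"
    by (simp only: mult.left_commute)
  finally show "ereal r * g (u *\<^sub>R x + (1 - u) *\<^sub>R y)
    \<le> ereal u * (ereal r * g x) + ereal (1 - u) * (ereal r * g y)" .
qed

lemma convex_econvex_le_econcave:
  assumes h: "econvex_on S h" and g: "econcave_on S g" and pos: "\<And>x. x \<in> S \<Longrightarrow> 0 \<le> g x"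
  shows "convex {x \<in> S. h x \<le> g x}"
proof (rule convexI_open_unit)
  fix x y and u :: real
  assume xy: "x \<in> {x \<in> S. h x \<le> g x}" "y \<in> {x \<in> S. h x \<le> g x}" and u: "0 < u" "u < 1"
  let ?z = "u *\<^sub>R x + (1 - u) *\<^sub>R y"
  have "?z \<in> S"
    using h xy u by (intro convexD) (auto simp: econvex_on_def)
  moreover have "h ?z \<le> g ?z"
  proof -
    have "h ?z \<le> ereal u * h x + ereal (1 - u) * h y"
      using h xy u by (simp add: econvex_on_def)
    also have "\<dots> \<le> ereal u * g x + ereal (1 - u) * g y"
      using xy u by (intro add_mono ereal_mult_left_mono) auto
    also have "\<dots> \<le> g ?z"
    proof -
      have nn: "0 \<le> ereal u * g x" "0 \<le> ereal (1 - u) * g y"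
        using xy u pos by (auto intro!: ereal_0_le_mult)
      have "- g ?z \<le> ereal u * - g x + ereal (1 - u) * - g y"
        using g xy u by (simp add: econvex_on_def econcave_on_def)
      also have "\<dots> = - (ereal u * g x) + - (ereal (1 - u) * g y)"
        by simp
      \<comment> \<open>Negation is not additive on opposite infinities; nonnegativity of both terms
        excludes that case.\<close>
      also have "\<dots> = - (ereal u * g x + ereal (1 - u) * g y)"
        using nn by (cases "ereal u * g x"; cases "ereal (1 - u) * g y") auto
      finally show ?thesis
        by (simp only: ereal_minus_le_minus)
    qed
    finally show ?thesis .
  qed
  ultimately show "?z \<in> {x \<in> S. h x \<le> g x}" by simp
qed

lemma convex_closedin_ratio_ge:
  assumes S: "convex S"
    and c: "\<And>x. x \<in> S \<Longrightarrow> 0 < c x" "econcave_on S c" "usc_on S c"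
    and s: "\<And>x. x \<in> S \<Longrightarrow> 0 \<le> s x \<and> s x < \<infinity>" "econvex_on S s" "lsc_on S s"
  shows "convex {x \<in> S. t \<le> c x / s x}" (is ?convex)
    and "closedin (top_of_set S) {x \<in> S. t \<le> c x / s x}" (is ?closed)
proof -
  let ?L = "\<lambda>r. {x \<in> S. ereal r * s x \<le> c x}"
  \<comment> \<open>The factor \<open>S\<close> matters for \<open>t \<le> 0\<close>, where no
    \<open>r\<close> qualifies and the indexed intersection is everything.\<close>
  have eq: "{x \<in> S. t \<le> c x / s x} = S \<inter> (\<Inter>r\<in>{r. 0 < r \<and> ereal r < t}. ?L r)"
  proof -
    have "t \<le> c x / s x \<longleftrightarrow> (\<forall>r>0. ereal r < t \<longrightarrow> ereal r * s x \<le> c x)" if "x \<in> S" for x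
    proof -
      have "0 \<le> c x / s x"
        using c(1)[OF that] s(1)[OF that]
        by (cases "s x = 0") (auto simp: ereal_pos_divide_zero)
      moreover have "ereal r \<le> c x / s x \<longleftrightarrow> ereal r * s x \<le> c x" if "0 < r" for r
        using c(1)[OF \<open>x \<in> S\<close>] s(1)[OF \<open>x \<in> S\<close>] that by (intro ereal_le_divide_iff) auto
      ultimately show ?thesis
        by (simp add: ereal_le_iff_pos_reals_le[of _ t] cong: imp_cong)
    qed
    then show ?thesis by auto
  qed
  have "convex (?L r)" if "0 < r" for r
    using c s that by (intro convex_econvex_le_econcave econvex_on_cmult) (auto intro: less_imp_le)
  then show ?convex
    unfolding eq using S by (intro convex_Int convex_INT) auto
  have "closedin (top_of_set S) (?L r)" if "0 < r" for r
    using c s usc_on_cmult[of S "\<lambda>x. - s x" r] that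
    by (intro closedin_usc_le) (auto simp: lsc_on_def)
  then have "closedin (top_of_set S) (\<Inter>(insert S (?L ` {r. 0 < r \<and> ereal r < t})))"
    by (intro closedin_Inter) auto
  then show ?closed
    unfolding eq by simp
qed

lemma convex_closedin_ratio_le:
  assumes S: "convex S"
    and c: "\<And>x. x \<in> S \<Longrightarrow> 0 < c x" "econvex_on S c" "lsc_on S c"
    and s: "\<And>x. x \<in> S \<Longrightarrow> 0 \<le> s x \<and> s x < \<infinity>" "econcave_on S s" "usc_on S s"
  shows "convex {x \<in> S. c x / s x \<le> t}" (is ?convex)
    and "closedin (top_of_set S) {x \<in> S. c x / s x \<le> t}" (is ?closed)
proof -
  let ?L = "\<lambda>r. {x \<in> S. c x \<le> ereal r * s x}"
  have pos: "0 \<le> c x / s x" if "x \<in> S" for x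
    using c(1)[OF that] s(1)[OF that]
    by (cases "s x = 0") (auto simp: ereal_pos_divide_zero)
  have L_convex: "convex (?L r)" if "0 < r" for r
    using c s that econvex_on_cmult[of S "\<lambda>x. - s x" r]
    by (intro convex_econvex_le_econcave) (auto simp: econcave_on_def)
  have L_closed: "closedin (top_of_set S) (?L r)" if "0 < r" for r
    using c s that by (intro closedin_usc_le usc_on_cmult) auto
  have "?convex \<and> ?closed"
  \<comment> \<open>Positive real levels detect only \<open>t \<ge> 0\<close>; below that the set is
    empty, as the ratio is nonnegative.\<close>
  proof (cases "0 \<le> t")
    case True
    have "c x / s x \<le> t \<longleftrightarrow> (\<forall>r>0. t < ereal r \<longrightarrow> c x \<le> ereal r * s x)" if "x \<in> S" for x
    proof -
      have "c x / s x \<le> ereal r \<longleftrightarrow> c x \<le> ereal r * s x" if "0 < r" for r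
        using c(1)[OF \<open>x \<in> S\<close>] s(1)[OF \<open>x \<in> S\<close>] that by (intro ereal_divide_le_iff) auto
      then show ?thesis
        by (simp add: ereal_ge_iff_pos_reals_ge[OF True] cong: imp_cong)
    qed
    then have eq: "{x \<in> S. c x / s x \<le> t} = S \<inter> (\<Inter>r\<in>{r. 0 < r \<and> t < ereal r}. ?L r)"
      by auto
    have "closedin (top_of_set S) (\<Inter>(insert S (?L ` {r. 0 < r \<and> t < ereal r})))"
      using L_closed by (intro closedin_Inter) auto
    then show ?thesis
      unfolding eq using S L_convex by (auto intro!: convex_Int convex_INT)
  next
    case False
    then have "{x \<in> S. c x / s x \<le> t} = {}"
      using pos by (auto dest: order_trans)
    then show ?thesis
      by (simp only: convex_empty closedin_empty simp_thms)
  qed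
  then show ?convex ?closed by auto
qed

section \<open>The minimax equality for the ratio\<close>

theorem theorem2p14:
  fixes \<R> :: "'a::real_tvs set" and \<Delta> :: "'b::real_tvs set"
    and cost score :: "'a \<Rightarrow> 'b \<Rightarrow> ereal"
  assumes "convex \<R>"
    and "\<Delta> \<noteq> {}" and "convex \<Delta>" and "compact \<Delta>"
    and "\<And>R \<mu>. R \<in> \<R> \<Longrightarrow> \<mu> \<in> \<Delta> \<Longrightarrow> cost R \<mu> \<in> {0<..\<infinity>}"
    and "semicontinuous_on \<R> \<Delta> cost" and "saddle_on \<R> \<Delta> cost"
    and "\<And>R \<mu>. R \<in> \<R> \<Longrightarrow> \<mu> \<in> \<Delta> \<Longrightarrow> score R \<mu> \<in> {0..<\<infinity>}"
    and "semicontinuous_on \<R> \<Delta> (\<lambda>R \<mu>. - score R \<mu>)"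
    and "saddle_on \<R> \<Delta> (\<lambda>R \<mu>. - score R \<mu>)"
  shows "(INF R\<in>\<R>. SUP \<mu>\<in>\<Delta>. cost R \<mu> / score R \<mu>) =
           (SUP \<mu>\<in>\<Delta>. INF R\<in>\<R>. cost R \<mu> / score R \<mu>) \<and>
         (\<forall>R\<in>\<R>. \<exists>\<mu>\<in>\<Delta>. cost R \<mu> / score R \<mu> = (SUP \<nu>\<in>\<Delta>. cost R \<nu> / score R \<nu>)) \<and>
         (\<exists>\<mu>\<in>\<Delta>. (INF R\<in>\<R>. cost R \<mu> / score R \<mu>) =
           (SUP \<nu>\<in>\<Delta>. INF R\<in>\<R>. cost R \<nu> / score R \<nu>))"
proof -
  let ?f = "\<lambda>R \<mu>. cost R \<mu> / score R \<mu>"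
  interpret quasi_saddle \<R> \<Delta> ?f
  proof
    \<comment> \<open>As \<open>- score\<close> is the saddle function, \<open>score\<close> is
      concave and upper semicontinuous in \<open>R\<close>, convex and lower semicontinuous in
      \<mu>.\<close>
    fix \<mu> t assume "\<mu> \<in> \<Delta>"
    then show "convex {R \<in> \<R>. ?f R \<mu> \<le> t}" "closedin (top_of_set \<R>) {R \<in> \<R>. ?f R \<mu> \<le> t}"
      using assms(1,5-10)
      by (intro convex_closedin_ratio_le;
          auto simp: semicontinuous_on_def saddle_on_def econcave_on_def lsc_on_def)+
  next
    fix R t assume "R \<in> \<R>"
    then show "convex {\<mu> \<in> \<Delta>. t \<le> ?f R \<mu>}" "closedin (top_of_set \<Delta>) {\<mu> \<in> \<Delta>. t \<le> ?f R \<mu>}"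
      using assms(3,5-10)
      by (intro convex_closedin_ratio_ge;
          auto simp: semicontinuous_on_def saddle_on_def econcave_on_def lsc_on_def)+
  qed (use assms in auto)
  let ?v = "INF R\<in>\<R>. SUP \<mu>\<in>\<Delta>. ?f R \<mu>" and ?w = "SUP \<mu>\<in>\<Delta>. INF R\<in>\<R>. ?f R \<mu>"
  \<comment> \<open>The infimum at this \<mu> lies between \<open>?v\<close> and \<open>?w\<close>;
    with the easy bound \<open>?w \<le> ?v\<close> all three agree, giving equality and the
    maximiser together.\<close>
  obtain \<mu> where \<mu>: "\<mu> \<in> \<Delta>" "\<And>R. R \<in> \<R> \<Longrightarrow> ?v \<le> ?f R \<mu>"
    using Sion_minimax[OF assms(2)] by blast
  have "?v \<le> (INF R\<in>\<R>. ?f R \<mu>)"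
    using \<mu>(2) by (intro INF_greatest)
  moreover have "(INF R\<in>\<R>. ?f R \<mu>) \<le> ?w"
    using \<mu>(1) by (rule SUP_upper)
  moreover have "?w \<le> ?v"
    by (intro SUP_least INF_greatest) (meson INF_lower SUP_upper order_trans)
  moreover have "\<exists>\<mu>\<in>\<Delta>. ?f R \<mu> = (SUP \<nu>\<in>\<Delta>. ?f R \<nu>)" if R: "R \<in> \<R>" for R
  proof -
    obtain \<mu>' where \<mu>': "\<mu>' \<in> \<Delta>" "(SUP \<nu>\<in>\<Delta>. ?f R \<nu>) \<le> ?f R \<mu>'"
      using quasi_saddle.Sion_minimax[OF quasi_saddle_singleton[OF R] assms(2)] by auto
    moreover have "?f R \<mu>' \<le> (SUP \<nu>\<in>\<Delta>. ?f R \<nu>)"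
      using \<mu>'(1) by (rule SUP_upper)
    ultimately show ?thesis
      by (meson antisym)
  qed
  ultimately show ?thesis
    using \<mu>(1) by (meson antisym order_trans)
qed

end
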